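(* Let $G$ be a free abelian group and let $R=\bigoplus_{g\in G}R_g$ be a $G$-graded ring. Then the nil radical of $R$ is a homogeneous ideal of $R$ with respect to the $G$-grading.
   Context: Rings are associative and are not assumed to have an identity element. The group $G$ is written additively and may have arbitrary (possibly infinite) rank. A $G$-graded ring is a ring $R$ with a decomposition $R=\bigoplus_{g\in G}R_g$ into additive subgroups with $R_gR_h\subseteq R_{g+h}$ for all $g,h\in G$. An element is homogeneous if it lies in some $R_g$. A (two-sided) ideal of a graded ring is homogeneous if it is generated, as an ideal, by homogeneous elements. An ideal is nil if each of its elements is nilpotent. The nil radical of $R$ is the largest nil two-sided ideal of $R$ (equivalently, the sum of all nil two-sided ideals of $R$, which is itself nil). *)

theory Defs
  imports "HOL-Algebra.Free_Abelian_Groups" HOL.Hull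
begin

text \<open>
  Rings are types of class \<^class>\<open>ring\<close>, which is associative and not assumed to be
  unital (nor commutative). The grading group is a type of class \<^class>\<open>ab_group_add\<close>.
\<close>

text \<open>
  \<^term>\<open>free_Abelian_group S\<close> is the group of finitely supported functions from \<open>S\<close> to the integers.
  Requiring \<open>S\<close> to be a set of elements of the group itself is no restriction, as a basis
  of the group can serve as \<open>S\<close>; there is no bound on its cardinality.
\<close>

definition free_abelian :: "'g::ab_group_add itself \<Rightarrow> bool" where
  "free_abelian _ \<longleftrightarrow>
     (\<exists>S :: 'g set. (\<lparr>carrier = UNIV, mult = (+), one = 0\<rparr> :: 'g monoid) \<cong> free_Abelian_group S)"

definition add_subgroup :: "'a::ab_group_add set \<Rightarrow> bool" where
  "add_subgroup H \<longleftrightarrow> 0 \<in> H \<and> (\<forall>x\<in>H. \<forall>y\<in>H. x + y \<in> H) \<and> (\<forall>x\<in>H. - x \<in> H)"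

text \<open>The second conjunct says that the ring is the internal direct sum of the \<open>A g\<close>.\<close>

definition graded_ring :: "('g::ab_group_add \<Rightarrow> 'r::ring set) \<Rightarrow> bool" where
  "graded_ring A \<longleftrightarrow>
     (\<forall>g. add_subgroup (A g)) \<and>
     (\<forall>r. \<exists>!f :: 'g \<Rightarrow> 'r.
        (\<forall>g. f g \<in> A g) \<and> finite {g. f g \<noteq> 0} \<and> r = (\<Sum>g | f g \<noteq> 0. f g)) \<and>
     (\<forall>g h. \<forall>a\<in>A g. \<forall>b\<in>A h. a * b \<in> A (g + h))"

definition two_sided_ideal :: "'r::ring set \<Rightarrow> bool" where
  "two_sided_ideal I \<longleftrightarrow> add_subgroup I \<and> (\<forall>r. \<forall>a\<in>I. r * a \<in> I \<and> a * r \<in> I)"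

text \<open>
  \<^term>\<open>two_sided_ideal hull S\<close> is the intersection of all two-sided ideals containing \<open>S\<close>,
  i.e. the ideal generated by \<open>S\<close>.
\<close>

definition homogeneous_ideal :: "('g::ab_group_add \<Rightarrow> 'r::ring set) \<Rightarrow> 'r set \<Rightarrow> bool" where
  "homogeneous_ideal A I \<longleftrightarrow>
     two_sided_ideal I \<and> (\<exists>S. S \<subseteq> (\<Union>g. A g) \<and> I = two_sided_ideal hull S)"

text \<open>
  Without an identity element the library power \<open>a ^ n\<close> is not available; the iterate
  \<open>((*) a ^^ n) a\<close> is the power of \<open>a\<close> with exponent \<open>n + 1\<close>.
\<close>

definition nilpotent :: "'r::ring \<Rightarrow> bool" where
  "nilpotent a \<longleftrightarrow> (\<exists>n. ((*) a ^^ n) a = 0)"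

definition nil_ideal :: "'r::ring set \<Rightarrow> bool" where
  "nil_ideal I \<longleftrightarrow> two_sided_ideal I \<and> (\<forall>a\<in>I. nilpotent a)"

text \<open>
  The order on sets is inclusion, so this is the largest nil ideal; \<open>nil_radical_greatest\<close>
  below shows that it exists.
\<close>

definition nil_radical :: "'r::ring set" where
  "nil_radical = (GREATEST N. nil_ideal N)"

lemma two_sided_idealD:
  assumes "two_sided_ideal I"
  shows "0 \<in> I" "x \<in> I \<Longrightarrow> y \<in> I \<Longrightarrow> x + y \<in> I" "x \<in> I \<Longrightarrow> - x \<in> I"
    "x \<in> I \<Longrightarrow> r * x \<in> I" "x \<in> I \<Longrightarrow> x * r \<in> I"
  using assms by (auto simp: two_sided_ideal_def add_subgroup_def)

lemma nil_idealI:
  assumes "0 \<in> I" "\<And>x y. x \<in> I \<Longrightarrow> y \<in> I \<Longrightarrow> x + y \<in> I" "\<And>x. x \<in> I \<Longrightarrow> - x \<in> I"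
    "\<And>r x. x \<in> I \<Longrightarrow> r * x \<in> I \<and> x * r \<in> I" "\<And>x. x \<in> I \<Longrightarrow> nilpotent x"
  shows "nil_ideal I"
  using assms by (simp add: nil_ideal_def two_sided_ideal_def add_subgroup_def)

lemma iterate_mult_assoc:
  fixes a :: "'r::ring"
  shows "((*) a ^^ m) x * y = ((*) a ^^ m) (x * y)"
  by (induction m) (simp_all add: mult.assoc)

lemma iterate_power:
  fixes a :: "'r::ring"
  shows "((*) (((*) a ^^ m) a) ^^ k) x = ((*) a ^^ (k * Suc m)) x"
proof (induction k)
  case (Suc k)
  have "((*) (((*) a ^^ m) a) ^^ Suc k) x = ((*) a ^^ m) (a * (((*) a ^^ (k * Suc m)) x))"
    by (simp add: Suc iterate_mult_assoc del: mult_Suc_right)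
  also have "\<dots> = ((*) a ^^ (Suc k * Suc m)) x"
    using funpow_add[of "Suc m" "k * Suc m" "(*) a"]
    by (simp add: funpow_swap1 del: mult_Suc_right)
  finally show ?case .
qed simp

lemma nilpotent_iterate:
  fixes a :: "'r::ring"
  assumes "nilpotent (((*) a ^^ m) a)"
  shows "nilpotent a"
proof -
  obtain k where "((*) a ^^ (k * Suc m)) (((*) a ^^ m) a) = 0"
    using assms by (auto simp: nilpotent_def iterate_power simp del: mult_Suc_right)
  hence "((*) a ^^ (k * Suc m + m)) a = 0"
    by (simp only: funpow_add o_apply)
  thus ?thesis by (auto simp: nilpotent_def)
qed

lemma iterate_add_diff:
  assumes I: "two_sided_ideal J" and b: "b \<in> J"
  shows "((*) (a + b) ^^ n) (a + b) - ((*) a ^^ n) a \<in> J"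
proof (induction n)
  case 0
  show ?case using b by simp
next
  case (Suc n)
  let ?u = "((*) (a + b) ^^ n) (a + b)" and ?v = "((*) a ^^ n) a"
  have "a * (?u - ?v) \<in> J" "b * ?u \<in> J"
    using two_sided_idealD(4)[OF I Suc] two_sided_idealD(5)[OF I b] by auto
  hence "a * (?u - ?v) + b * ?u \<in> J"
    by (rule two_sided_idealD(2)[OF I])
  moreover have "a * (?u - ?v) + b * ?u = (a + b) * ?u - a * ?v"
    by (simp only: right_diff_distrib distrib_right) simp
  ultimately show ?case by simp
qed

lemma nil_ideal_add:
  assumes "nil_ideal I" "nil_ideal J"
  shows "nil_ideal {a + b | a b. a \<in> I \<and> b \<in> J}"
proof -
  have I: "two_sided_ideal I" and J: "two_sided_ideal J"
    using assms by (auto simp: nil_ideal_def)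
  note DI = two_sided_idealD[OF I] and DJ = two_sided_idealD[OF J]
  let ?S = "{a + b | a b. a \<in> I \<and> b \<in> J}"
  have "0 \<in> ?S" using DI(1) DJ(1) by force
  moreover have "x + y \<in> ?S" if xy: "x \<in> ?S" "y \<in> ?S" for x y
  proof -
    obtain a b c d where "x = a + b" "y = c + d" "a \<in> I" "c \<in> I" "b \<in> J" "d \<in> J"
      using xy by blast
    moreover have "a + b + (c + d) = (a + c) + (b + d)" by (simp add: algebra_simps)
    moreover have "a + c \<in> I" "b + d \<in> J" using calculation DI(2) DJ(2) by auto
    ultimately show ?thesis by (metis (mono_tags, lifting) mem_Collect_eq)
  qed
  moreover have "- x \<in> ?S" if x: "x \<in> ?S" for x
  proof -
    obtain a b where "x = a + b" "a \<in> I" "b \<in> J" using x by blast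
    moreover have "- (a + b) = - a + - b" by simp
    moreover have "- a \<in> I" "- b \<in> J" using calculation DI(3) DJ(3) by auto
    ultimately show ?thesis by blast
  qed
  moreover have "r * x \<in> ?S \<and> x * r \<in> ?S" if x: "x \<in> ?S" for r x
  proof -
    obtain a b where "x = a + b" "a \<in> I" "b \<in> J" using x by blast
    moreover have "r * (a + b) = r * a + r * b" "(a + b) * r = a * r + b * r"
      by (simp_all add: algebra_simps)
    moreover have "r * a \<in> I" "a * r \<in> I" "r * b \<in> J" "b * r \<in> J"
      using calculation DI(4,5) DJ(4,5) by auto
    ultimately show ?thesis by blast
  qed
  moreover have "nilpotent x" if x: "x \<in> ?S" for x
  proof -
    obtain a b where ab: "x = a + b" "a \<in> I" "b \<in> J" using x by blast
    obtain n where "((*) a ^^ n) a = 0"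
      using assms(1) ab by (auto simp: nil_ideal_def nilpotent_def)
    hence "((*) x ^^ n) x \<in> J" using iterate_add_diff[OF J ab(3), where a = a and n = n] ab(1) by simp
    thus ?thesis using assms(2) nilpotent_iterate by (auto simp: nil_ideal_def)
  qed
  ultimately show ?thesis by (rule nil_idealI)
qed

lemma nil_ideal_Union: "nil_ideal (\<Union>{I :: 'r::ring set. nil_ideal I})"
proof -
  let ?U = "\<Union>{I :: 'r set. nil_ideal I}"
  have D: "two_sided_ideal I" if "nil_ideal I" for I :: "'r set"
    using that by (simp add: nil_ideal_def)
  have "nil_ideal {0 :: 'r}"
    by (auto simp: nil_ideal_def two_sided_ideal_def add_subgroup_def nilpotent_def intro: exI[of _ 0])
  hence "0 \<in> ?U" by blast
  moreover have "x + y \<in> ?U" if xy: "x \<in> ?U" "y \<in> ?U" for x y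
  proof -
    obtain I J where "nil_ideal I" "nil_ideal J" "x \<in> I" "y \<in> J" using xy by blast
    moreover from this have "x + y \<in> {a + b | a b. a \<in> I \<and> b \<in> J}" by blast
    ultimately show ?thesis using nil_ideal_add[of I J]
      by (intro UnionI[of "{a + b | a b. a \<in> I \<and> b \<in> J}"]) simp_all
  qed
  moreover have "- x \<in> ?U" if x: "x \<in> ?U" for x
  proof -
    obtain I where "nil_ideal I" "x \<in> I" using x by blast
    thus ?thesis using two_sided_idealD(3)[OF D, of I x] by auto
  qed
  moreover have "r * x \<in> ?U \<and> x * r \<in> ?U" if x: "x \<in> ?U" for r x
  proof -
    obtain I where "nil_ideal I" "x \<in> I" using x by blast
    thus ?thesis using two_sided_idealD(4,5)[OF D, of I x r] by auto
  qed
  moreover have "nilpotent x" if "x \<in> ?U" for x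
    using that by (auto simp: nil_ideal_def)
  ultimately show ?thesis by (rule nil_idealI)
qed

lemma nil_radical_greatest:
  shows "nil_ideal (nil_radical :: 'r::ring set)"
    and "nil_ideal I \<Longrightarrow> I \<subseteq> (nil_radical :: 'r set)"
proof -
  have eq: "(nil_radical :: 'r set) = \<Union>{I. nil_ideal I}"
    unfolding nil_radical_def
    by (rule Greatest_equality) (use nil_ideal_Union in auto)
  show "nil_ideal (nil_radical :: 'r set)" unfolding eq by (rule nil_ideal_Union)
  show "I \<subseteq> (nil_radical :: 'r set)" if "nil_ideal I" using that unfolding eq by blast
qed

end

theory Submission
  imports Defs HOL.Modules
begin

text \<open>
  Let \<open>N\<close> be the nil radical and write \<open>a g\<close> for the component of \<open>a\<close> of degree \<open>g\<close>. The theorem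
  says that all components of an element of \<open>N\<close> lie in \<open>N\<close>. The elements with this property form a
  homogeneous ideal \<open>core N\<close>, and all equalities below are meant modulo \<open>core N\<close>.

  Suppose that some element of \<open>N\<close> is not in \<open>core N\<close>, and let \<open>a\<close> be one with as few components
  outside \<open>N\<close> as possible; let \<open>b\<close> be one of these components. For homogeneous \<open>r\<close>, the element
  \<open>a * r * b - b * r * a\<close> of \<open>N\<close> has fewer components outside \<open>N\<close>, because the contributions
  of \<open>b\<close> itself cancel. So \<open>a * r * b = b * r * a\<close> for all \<open>r\<close>: the element \<open>a\<close> behaves like
  \<open>b\<close> times a central element \<open>f\<close> of an extension ring. Concretely, the correspondence of
  \<open>z = (\<Sum>i. p i * b * q i)\<close> with \<open>w = (\<Sum>i. p i * a * q i)\<close>, called \<open>paired\<close> below,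
  behaves like \<open>w = z * f\<close>; in particular \<open>z\<close> and \<open>w\<close> commute (\<open>paired_commute\<close>).

  A free abelian group has an additive map to the integers that takes its least value on the degrees
  of the components of \<open>a\<close> outside \<open>N\<close> at a single degree (\<open>unique_minimizer\<close>). If \<open>b\<close> is the
  component of that degree, then \<open>f\<close> is 1 plus terms of higher degree, so it is
  cancellable: \<open>w * y = 0\<close> implies \<open>z * y = 0\<close> (\<open>paired_regular\<close>). Since \<open>w\<close> lies in
  \<open>N\<close>, some power of it vanishes, and replacing its factors by \<open>z\<close> one at a time shows that \<open>z\<close>
  is nilpotent (\<open>paired_nilpotent\<close>). Hence the ideal of all such \<open>z\<close> is nil and contained in \<open>N\<close>.
  As \<open>N\<close> is a semiprime ideal, this puts \<open>b\<close> into \<open>N\<close>, contrary to its choice.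
\<close>

section \<open>Additive integer-valued maps on free abelian groups\<close>

text \<open>Some coordinate of \<open>g\<close> with respect to a basis is nonzero.\<close>

lemma free_abelian_separated:
  fixes g :: "'g::ab_group_add"
  assumes "free_abelian TYPE('g)" and "g \<noteq> 0"
  shows "\<exists>\<pi> :: 'g \<Rightarrow> int. additive \<pi> \<and> \<pi> g \<noteq> 0"
proof -
  obtain S :: "'g set" and f
    where f: "f \<in> iso (\<lparr>carrier = UNIV, mult = (+), one = 0\<rparr> :: 'g monoid) (free_Abelian_group S)"
    using assms(1) by (auto simp: free_abelian_def is_iso_def)
  have add: "f (x + y) = f x + f y" for x y
    using f by (auto simp: iso_def hom_def)
  have inj: "inj f"
    using f by (auto simp: iso_def bij_betw_def)
  have "f 0 = 0"
    using add[of 0 0] by simp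
  hence "f g \<noteq> 0"
    using inj assms(2) by (metis injD)
  then obtain s where "Poly_Mapping.lookup (f g) s \<noteq> 0"
    by (metis poly_mapping_eqI lookup_zero)
  moreover have "additive (\<lambda>x. Poly_Mapping.lookup (f x) s)"
    by standard (simp add: add lookup_add)
  ultimately show ?thesis by blast
qed

text \<open>
  If \<open>\<pi>\<close> is nonzero on \<open>D\<close> but vanishes at a further point \<open>c\<close>, add to a large multiple of \<open>\<pi>\<close>
  a map \<open>\<sigma>\<close> that does not vanish at \<open>c\<close>; the multiple dominates \<open>\<sigma>\<close> on \<open>D\<close>.
\<close>

lemma additive_nonzero_on_finite:
  fixes D :: "'g::ab_group_add set"
  assumes sep: "\<And>g :: 'g. g \<noteq> 0 \<Longrightarrow> \<exists>\<pi> :: 'g \<Rightarrow> int. additive \<pi> \<and> \<pi> g \<noteq> 0"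
    and "finite D" "0 \<notin> D"
  shows "\<exists>\<pi> :: 'g \<Rightarrow> int. additive \<pi> \<and> (\<forall>g\<in>D. \<pi> g \<noteq> 0)"
  using assms(2,3)
proof (induction D)
  case empty
  have "additive (\<lambda>_ :: 'g. 0 :: int)" by standard simp
  thus ?case by blast
next
  case (insert c D)
  then obtain \<pi> :: "'g \<Rightarrow> int" where \<pi>: "additive \<pi>" "\<forall>g\<in>D. \<pi> g \<noteq> 0" by auto
  obtain \<sigma> :: "'g \<Rightarrow> int" where \<sigma>: "additive \<sigma>" "\<sigma> c \<noteq> 0"
    using sep[of c] insert.prems by blast
  show ?case
  proof (cases "\<pi> c = 0")
    case False
    with \<pi> show ?thesis by auto
  next
    case True
    define M where "M = 1 + (\<Sum>g\<in>D. \<bar>\<sigma> g\<bar>)"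
    have "additive (\<lambda>g. M * \<pi> g + \<sigma> g)"
      by standard (simp add: additive.add[OF \<pi>(1)] additive.add[OF \<sigma>(1)] algebra_simps)
    moreover have "M * \<pi> g + \<sigma> g \<noteq> 0" if g: "g \<in> D" for g
    proof
      assume *: "M * \<pi> g + \<sigma> g = 0"
      have M: "\<bar>\<sigma> g\<bar> < M"
        using member_le_sum[OF g, of "\<lambda>g. \<bar>\<sigma> g\<bar>"] insert.hyps(1) by (simp add: M_def)
      have "\<bar>M\<bar> * 1 \<le> \<bar>M\<bar> * \<bar>\<pi> g\<bar>"
        using \<pi>(2) g by (intro mult_left_mono) auto
      also have "\<dots> = \<bar>\<sigma> g\<bar>"
        using * by (simp flip: abs_mult)
      finally show False using M by simp
    qed
    moreover have "M * \<pi> c + \<sigma> c \<noteq> 0"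
      using True \<sigma>(2) by simp
    ultimately show ?thesis by (intro exI[of _ "\<lambda>g. M * \<pi> g + \<sigma> g"]) auto
  qed
qed

text \<open>
  An additive map that is nonzero on all differences of distinct elements of \<open>F\<close> is injective on \<open>F\<close>.
  It takes over the role of an ordering of the grading group.
\<close>

lemma unique_minimizer:
  fixes F :: "'g::ab_group_add set"
  assumes "free_abelian TYPE('g)" and "finite F" "F \<noteq> {}"
  obtains \<pi> :: "'g \<Rightarrow> int" and d
    where "additive \<pi>" "d \<in> F" "\<And>g. g \<in> F \<Longrightarrow> g \<noteq> d \<Longrightarrow> \<pi> d < \<pi> g"
proof -
  define D where "D = (\<lambda>(g, h). g - h) ` (F \<times> F) - {0}"
  have "finite D" "0 \<notin> D" using assms(2) by (auto simp: D_def)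
  then obtain \<pi> :: "'g \<Rightarrow> int" where \<pi>: "additive \<pi>" "\<And>g. g \<in> D \<Longrightarrow> \<pi> g \<noteq> 0"
    using additive_nonzero_on_finite[OF free_abelian_separated[OF assms(1)]] by meson
  obtain d where d: "d \<in> F" "\<And>g. g \<in> F \<Longrightarrow> \<pi> d \<le> \<pi> g"
    using arg_min_if_finite[OF assms(2,3), of \<pi>] by (meson leI)
  have "\<pi> d < \<pi> g" if g: "g \<in> F" "g \<noteq> d" for g
  proof -
    have "g - d \<in> D" using g d(1) by (force simp: D_def)
    hence "\<pi> g \<noteq> \<pi> d" using \<pi> by (metis additive.diff diff_self)
    thus ?thesis using d(2)[OF g(1)] by simp
  qed
  thus thesis using that \<pi>(1) d(1) by blast
qed

section \<open>Two-sided ideals and the nil radical\<close>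

lemma ideal_diff:
  assumes "two_sided_ideal I" "x \<in> I" "y \<in> I"
  shows "x - y \<in> I"
  using two_sided_idealD(2,3)[OF assms(1)] assms(2,3) by (metis diff_conv_add_uminus)

lemma ideal_sum:
  assumes "two_sided_ideal I" "\<And>i. i \<in> F \<Longrightarrow> f i \<in> I"
  shows "sum f F \<in> I"
  using assms(2) by (induction F rule: infinite_finite_induct) (auto intro: two_sided_idealD[OF assms(1)])

lemma two_sided_ideal_hull: "two_sided_ideal (two_sided_ideal hull S)"
  by (rule hull_in) (auto simp: two_sided_ideal_def add_subgroup_def)

lemma nil_radical_ideal: "two_sided_ideal (nil_radical :: 'r::ring set)"
  using nil_radical_greatest(1)[where ?'r = 'r] by (simp add: nil_ideal_def)

lemma nilpotent_mod_nil_radical: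
  fixes a :: "'r::ring"
  assumes "((*) a ^^ m) a \<in> nil_radical"
  shows "nilpotent a"
  using assms nil_radical_greatest(1) nilpotent_iterate by (auto simp: nil_ideal_def)

text \<open>
  The condition on \<open>x\<close> extends to the ideal \<open>X\<close> generated by \<open>x\<close>, one factor at a time:
  \<open>y * r * y'\<close> is in the nil radical for all \<open>y\<close> and \<open>y'\<close> in \<open>X\<close>. In particular the cubes of the
  elements of \<open>X\<close> are in the nil radical, so that \<open>X\<close> is nil. Cubes rather than squares occur because
  the ring may have no identity element to take for \<open>r\<close>.
\<close>

lemma nil_radical_semiprime:
  fixes x :: "'r::ring"
  assumes x: "\<And>r. x * r * x \<in> nil_radical"
  shows "x \<in> nil_radical"
proof -
  note N = two_sided_idealD[OF nil_radical_ideal[where ?'r = 'r]]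
  define X where "X = two_sided_ideal hull {x}"
  have "two_sided_ideal {y. \<forall>r. x * r * y \<in> nil_radical}"
    unfolding two_sided_ideal_def add_subgroup_def mem_Collect_eq
  proof (intro conjI ballI allI)
    fix s y r assume "y \<in> {y. \<forall>r. x * r * y \<in> nil_radical}"
    hence y: "x * r * y \<in> nil_radical" for r by blast
    show "x * r * (s * y) \<in> nil_radical" using y[of "r * s"] by (simp add: mult.assoc)
    show "x * r * (y * s) \<in> nil_radical" using N(5)[OF y] by (simp add: mult.assoc)
  qed (use N(1-3) in \<open>simp_all add: distrib_left\<close>)
  hence 1: "X \<subseteq> {y. \<forall>r. x * r * y \<in> nil_radical}"
    unfolding X_def using x by (intro hull_minimal) auto
  have "two_sided_ideal {y. \<forall>r. \<forall>y'\<in>X. y * r * y' \<in> nil_radical}"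
    unfolding two_sided_ideal_def add_subgroup_def mem_Collect_eq
  proof (intro conjI ballI allI)
    fix s y r y' assume "y \<in> {y. \<forall>r. \<forall>y'\<in>X. y * r * y' \<in> nil_radical}" and y': "y' \<in> X"
    hence y: "y * r * y' \<in> nil_radical" for r using y' by blast
    show "s * y * r * y' \<in> nil_radical" using N(4)[OF y] by (simp add: mult.assoc)
    show "y * s * r * y' \<in> nil_radical" using y[of "s * r"] by (simp add: mult.assoc)
  qed (use N(1-3) in \<open>simp_all add: distrib_right\<close>)
  hence 2: "X \<subseteq> {y. \<forall>r. \<forall>y'\<in>X. y * r * y' \<in> nil_radical}"
    using 1 by (subst X_def, intro hull_minimal) auto
  have "nilpotent y" if "y \<in> X" for y
  proof (rule nilpotent_mod_nil_radical)
    show "((*) y ^^ 2) y \<in> nil_radical"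
      using 2 that by (auto simp: numeral_2_eq_2 mult.assoc)
  qed
  hence "nil_ideal X"
    by (simp add: nil_ideal_def two_sided_ideal_hull X_def)
  thus ?thesis using nil_radical_greatest(2) hull_subset[of "{x}"] by (auto simp: X_def)
qed

lemma nil_radical_sandwich:
  fixes x :: "'r::ring"
  assumes x: "\<And>p q. p * x * q \<in> nil_radical"
  shows "x \<in> nil_radical"
proof (rule nil_radical_semiprime, rule nil_radical_semiprime)
  fix r s
  show "x * r * x * s * (x * r * x) \<in> nil_radical"
    using x[of "x * r" "s * x * r * x"] by (simp add: mult.assoc)
qed

section \<open>Homogeneous components\<close>

locale grading =
  fixes A :: "'g::ab_group_add \<Rightarrow> 'r::ring set"
  assumes graded: "graded_ring A"
begin

lemma zero_mem: "0 \<in> A g"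
  and add_mem: "x \<in> A g \<Longrightarrow> y \<in> A g \<Longrightarrow> x + y \<in> A g"
  and uminus_mem: "x \<in> A g \<Longrightarrow> - x \<in> A g"
  and mult_mem: "x \<in> A g \<Longrightarrow> y \<in> A h \<Longrightarrow> x * y \<in> A (g + h)"
  using graded by (auto simp: graded_ring_def add_subgroup_def)

definition component :: "'r \<Rightarrow> 'g \<Rightarrow> 'r" where
  "component r = (THE f. (\<forall>g. f g \<in> A g) \<and> finite {g. f g \<noteq> 0} \<and> r = (\<Sum>g | f g \<noteq> 0. f g))"

lemma component:
  shows component_mem: "component r g \<in> A g"
    and finite_support: "finite {g. component r g \<noteq> 0}"
    and sum_components: "(\<Sum>g | component r g \<noteq> 0. component r g) = r"
proof -
  have "\<exists>!f. (\<forall>g. f g \<in> A g) \<and> finite {g. f g \<noteq> 0} \<and> r = (\<Sum>g | f g \<noteq> 0. f g)"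
    using graded by (simp add: graded_ring_def)
  from theI'[OF this] show "component r g \<in> A g" "finite {g. component r g \<noteq> 0}"
    "(\<Sum>g | component r g \<noteq> 0. component r g) = r"
    by (auto simp flip: component_def)
qed

text \<open>
  The set \<open>F\<close> may be larger than the support of \<open>f\<close>, so that the components of sums and products
  can be read off from any finite decomposition.
\<close>

lemma component_unique:
  assumes "\<And>g. f g \<in> A g" "finite F" "\<And>g. g \<notin> F \<Longrightarrow> f g = 0" "r = sum f F"
  shows "component r = f"
proof -
  have ex1: "\<exists>!f. (\<forall>g. f g \<in> A g) \<and> finite {g. f g \<noteq> 0} \<and> r = (\<Sum>g | f g \<noteq> 0. f g)"
    using graded by (simp add: graded_ring_def)
  have sub: "{g. f g \<noteq> 0} \<subseteq> F" using assms(3) by blast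
  have "sum f F = (\<Sum>g | f g \<noteq> 0. f g)"
    using assms(2) sub by (intro sum.mono_neutral_right) auto
  hence "(\<forall>g. f g \<in> A g) \<and> finite {g. f g \<noteq> 0} \<and> r = (\<Sum>g | f g \<noteq> 0. f g)"
    using assms finite_subset[OF sub] by auto
  thus ?thesis unfolding component_def by (rule the1_equality[OF ex1])
qed

lemma sum_components_superset:
  assumes "finite F" "{g. component r g \<noteq> 0} \<subseteq> F"
  shows "sum (component r) F = r"
proof -
  have "sum (component r) F = (\<Sum>g | component r g \<noteq> 0. component r g)"
    using assms by (intro sum.mono_neutral_right) auto
  thus ?thesis by (simp add: sum_components)
qed

lemma component_add: "component (x + y) g = component x g + component y g"
proof -
  let ?F = "{g. component x g \<noteq> 0} \<union> {g. component y g \<noteq> 0}"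
  have "component (x + y) = (\<lambda>g. component x g + component y g)"
    by (rule component_unique[of _ ?F])
      (auto simp: component_mem add_mem finite_support sum.distrib sum_components_superset)
  thus ?thesis by simp
qed

lemma component_zero: "component 0 g = 0"
  using component_add[of 0 0] by simp

lemma component_diff: "component (x - y) g = component x g - component y g"
  using component_add[of "x - y" y] by (simp add: algebra_simps)

lemma component_uminus: "component (- x) g = - component x g"
  using component_diff[of 0 x] by (simp add: component_zero)

lemma component_sum: "component (sum f F) g = (\<Sum>i\<in>F. component (f i) g)"
  by (induction F rule: infinite_finite_induct) (simp_all add: component_zero component_add)

lemma component_homogeneous:
  assumes "x \<in> A h"
  shows "component x g = (if g = h then x else 0)"
proof -
  have "component x = (\<lambda>g. if g = h then x else 0)"
    by (rule component_unique[of _ "{h}"]) (use assms zero_mem in auto)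
  thus ?thesis by simp
qed

lemma component_mult_left:
  assumes r: "r \<in> A h"
  shows "component (r * x) g = r * component x (g - h)"
proof -
  let ?F = "{g. component x g \<noteq> 0}"
  have mem: "r * component x (g - h) \<in> A g" for g
    using mult_mem[OF r component_mem, of x "g - h"] by simp
  have "component (r * x) = (\<lambda>g. r * component x (g - h))"
  proof (rule component_unique[of _ "(+) h ` ?F"])
    show "r * component x (g - h) = 0" if "g \<notin> (+) h ` ?F" for g
      using that image_eqI[of g "(+) h" "g - h" ?F] by (cases "component x (g - h) = 0") auto
    have "(\<Sum>g\<in>(+) h ` ?F. r * component x (g - h)) = (\<Sum>g\<in>?F. r * component x g)"
      by (subst sum.reindex) (auto intro!: inj_onI)
    thus "r * x = (\<Sum>g\<in>(+) h ` ?F. r * component x (g - h))"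
      by (simp add: sum_components flip: sum_distrib_left)
  qed (auto simp: mem finite_support)
  thus ?thesis by simp
qed

lemma component_mult_right:
  assumes r: "r \<in> A h"
  shows "component (x * r) g = component x (g - h) * r"
proof -
  let ?F = "{g. component x g \<noteq> 0}"
  have mem: "component x (g - h) * r \<in> A g" for g
    using mult_mem[OF component_mem r, of x "g - h"] by simp
  have "component (x * r) = (\<lambda>g. component x (g - h) * r)"
  proof (rule component_unique[of _ "(+) h ` ?F"])
    show "component x (g - h) * r = 0" if "g \<notin> (+) h ` ?F" for g
      using that image_eqI[of g "(+) h" "g - h" ?F] by (cases "component x (g - h) = 0") auto
    have "(\<Sum>g\<in>(+) h ` ?F. component x (g - h) * r) = (\<Sum>g\<in>?F. component x g * r)"
      by (subst sum.reindex) (auto intro!: inj_onI)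
    thus "x * r = (\<Sum>g\<in>(+) h ` ?F. component x (g - h) * r)"
      by (simp add: sum_components flip: sum_distrib_right)
  qed (auto simp: mem finite_support)
  thus ?thesis by simp
qed

lemma homogeneous_induct [case_names homogeneous add]:
  assumes "\<And>h r. r \<in> A h \<Longrightarrow> P r" "\<And>x y. P x \<Longrightarrow> P y \<Longrightarrow> P (x + y)"
  shows "P r"
proof -
  have "P (\<Sum>g\<in>F. component r g)" for F
    by (induction F rule: infinite_finite_induct)
      (simp_all add: assms(2) assms(1)[OF zero_mem] assms(1)[OF component_mem])
  thus ?thesis by (metis sum_components)
qed

text \<open>For a two-sided ideal \<open>I\<close>, this is the largest homogeneous ideal contained in \<open>I\<close>.\<close>

definition core :: "'r set \<Rightarrow> 'r set" where
  "core I = {r. \<forall>g. component r g \<in> I}"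

lemma core_subset:
  assumes "two_sided_ideal I"
  shows "core I \<subseteq> I"
proof
  fix r assume "r \<in> core I"
  thus "r \<in> I"
    using ideal_sum[OF assms, of "{g. component r g \<noteq> 0}" "component r"]
    by (simp add: core_def sum_components)
qed

lemma core_homogeneous:
  assumes "two_sided_ideal I" "x \<in> A g" "x \<in> I"
  shows "x \<in> core I"
  using assms two_sided_idealD(1) by (auto simp: core_def component_homogeneous)

lemma core_ideal:
  assumes "two_sided_ideal I"
  shows "two_sided_ideal (core I)"
proof -
  note I = two_sided_idealD[OF assms]
  have "r * x \<in> core I \<and> x * r \<in> core I" if "x \<in> core I" for r x
  proof (induction r rule: homogeneous_induct)
    case (homogeneous h r)
    thus ?case using that I by (simp add: core_def component_mult_left component_mult_right)
  next
    case (add r s)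
    thus ?case using I by (simp add: core_def distrib_left distrib_right component_add)
  qed
  thus ?thesis
    using I by (auto simp: two_sided_ideal_def add_subgroup_def core_def
        component_zero component_add component_uminus)
qed

lemma homogeneous_ideal_if_core:
  assumes "two_sided_ideal I" "I \<subseteq> core I"
  shows "homogeneous_ideal A I"
proof -
  let ?S = "I \<inter> (\<Union>g. A g)"
  have "r \<in> two_sided_ideal hull ?S" if r: "r \<in> I" for r
  proof -
    have "component r g \<in> two_sided_ideal hull ?S" for g
      using r assms(2) component_mem by (intro hull_inc) (force simp: core_def)
    thus ?thesis
      using ideal_sum[OF two_sided_ideal_hull] by (metis sum_components)
  qed
  moreover have "two_sided_ideal hull ?S \<subseteq> I"
    using assms(1) by (intro hull_minimal) auto
  ultimately show ?thesis
    using assms(1) by (auto simp: homogeneous_ideal_def intro!: exI[of _ ?S])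
qed

end

section \<open>Replacing a component by the whole element\<close>

text \<open>
  The pairs \<open>(\<Sum>i. p i * b * q i, \<Sum>i. p i * a * q i)\<close>. The second entry is not determined by the
  first one, so this is a relation; it is a sub-bimodule of the square of the ring.
\<close>

inductive paired :: "'r::ring \<Rightarrow> 'r \<Rightarrow> 'r \<Rightarrow> 'r \<Rightarrow> bool" for b a where
  zero: "paired b a 0 0"
| add: "paired b a x w \<Longrightarrow> paired b a (x + p * b * q) (w + p * a * q)"

lemma paired_add:
  assumes "paired b a x w" "paired b a x' w'"
  shows "paired b a (x + x') (w + w')"
  using assms(2)
proof induction
  case zero
  show ?case using assms(1) by simp
next
  case (add x' w' p q)
  show ?case using paired.add[OF add.IH, of p q] by (simp add: add.assoc)
qed

lemma paired_mult_left: "paired b a x w \<Longrightarrow> paired b a (r * x) (r * w)"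
proof (induction rule: paired.induct)
  case zero
  show ?case using paired.zero by simp
next
  case (add x w p q)
  show ?case using paired.add[OF add.IH, of "r * p" q] by (simp add: distrib_left mult.assoc)
qed

lemma paired_mult_right: "paired b a x w \<Longrightarrow> paired b a (x * r) (w * r)"
proof (induction rule: paired.induct)
  case zero
  show ?case using paired.zero by simp
next
  case (add x w p q)
  show ?case using paired.add[OF add.IH, of p "q * r"] by (simp add: distrib_right mult.assoc)
qed

lemma paired_uminus: "paired b a x w \<Longrightarrow> paired b a (- x) (- w)"
proof (induction rule: paired.induct)
  case zero
  show ?case using paired.zero by simp
next
  case (add x w p q)
  show ?case using paired.add[OF add.IH, of "- p" q] by simp
qed

lemma paired_ideal:
  "two_sided_ideal {x. \<exists>w. paired b a x w}"
  unfolding two_sided_ideal_def add_subgroup_def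
  by (auto intro: paired.zero paired_add paired_uminus paired_mult_left paired_mult_right)

lemma paired_in_ideal:
  assumes "two_sided_ideal I" "a \<in> I" "paired b a x w"
  shows "w \<in> I"
  using assms(3)
  by induction (use assms(2) two_sided_idealD[OF assms(1)] in auto)

text \<open>
  Exchanging \<open>a\<close> and \<open>b\<close> inside \<open>p * a * (q * r) * b\<close>, term by term. The same is done once more in
  \<open>paired_commute\<close>, which says that \<open>(x * f) * x'\<close> and \<open>x * (x' * f)\<close> agree if \<open>f\<close> is the
  central factor that turns \<open>b\<close> into \<open>a\<close>.
\<close>

lemma paired_exchange:
  assumes I: "two_sided_ideal I" and ab: "\<And>r. a * r * b - b * r * a \<in> I" and x: "paired b a x w"
  shows "w * r * b - x * r * a \<in> I"
  using x
proof induction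
  case zero
  show ?case using two_sided_idealD(1)[OF I] by simp
next
  case (add x w p q)
  have "p * (a * (q * r) * b - b * (q * r) * a) \<in> I"
    using ab two_sided_idealD(4)[OF I] by blast
  from two_sided_idealD(2)[OF I add.IH this] show ?case
    by (simp add: algebra_simps)
qed

lemma paired_commute:
  assumes I: "two_sided_ideal I" and ab: "\<And>r. a * r * b - b * r * a \<in> I"
    and x: "paired b a x w" and x': "paired b a x' w'"
  shows "w * x' - x * w' \<in> I"
  using x'
proof induction
  case zero
  show ?case using two_sided_idealD(1)[OF I] by simp
next
  case (add x' w' p q)
  have "(w * p * b - x * p * a) * q \<in> I"
    using paired_exchange[OF I ab x] two_sided_idealD(5)[OF I] by blast
  from two_sided_idealD(2)[OF I add.IH this] show ?case
    by (simp add: algebra_simps)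
qed

text \<open>
  The factor that turns \<open>b\<close> into \<open>a\<close> is cancellable because its lowest term is 1. If \<open>x\<close> is not in
  the core, let \<open>y\<close> be its component of lowest \<open>\<pi>\<close>-degree outside \<open>N\<close>. Since \<open>w * r * b\<close>
  is in the core, so is \<open>x * r * a\<close>, which for homogeneous \<open>r\<close> has the component \<open>y * r * b\<close>, up to
  an element of \<open>N\<close>. So \<open>y * r * b\<close> is in the core for all \<open>r\<close>. But \<open>x\<close> is a sum of elements
  \<open>p * b * q\<close>, hence \<open>y * r * x\<close> is in the core too, and its component \<open>y * r * y\<close>, for homogeneous
  \<open>r\<close>, is in \<open>N\<close>. As \<open>N\<close> is semiprime, \<open>y\<close> is in \<open>N\<close>, a contradiction.
\<close>

lemma (in grading) paired_regular:
  fixes \<pi> :: "'g \<Rightarrow> int"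
  assumes N: "two_sided_ideal N"
    and semiprime: "\<And>x. (\<And>r. x * r * x \<in> N) \<Longrightarrow> x \<in> N"
    and ab: "\<And>r. a * r * b - b * r * a \<in> core N"
    and b: "b = component a d"
    and \<pi>: "additive \<pi>"
    and d: "\<And>g. component a g \<notin> N \<Longrightarrow> g \<noteq> d \<Longrightarrow> \<pi> d < \<pi> g"
    and x: "paired b a x w" and w: "w \<in> core N"
  shows "x \<in> core N"
proof (rule ccontr)
  note C = core_ideal[OF N]
  have bd: "b \<in> A d" by (simp add: b component_mem)
  assume "x \<notin> core N"
  hence ne: "{e. component x e \<notin> N} \<noteq> {}" by (auto simp: core_def)
  have fin: "finite {e. component x e \<notin> N}"
    by (rule finite_subset[OF _ finite_support[of x]]) (use two_sided_idealD(1)[OF N] in auto)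
  obtain e where e: "component x e \<notin> N" "\<And>u. component x u \<notin> N \<Longrightarrow> \<pi> e \<le> \<pi> u"
    using arg_min_if_finite[OF fin ne, of \<pi>] by (metis (mono_tags, lifting) leI mem_Collect_eq)
  let ?y = "component x e" and ?F = "insert e {g. component x g \<noteq> 0}"
  have yb: "?y * r * b \<in> core N" for r
  proof (induction r rule: homogeneous_induct)
    case (homogeneous h r)
    have "w * r * b \<in> core N" using w two_sided_idealD(5)[OF C] by blast
    from ideal_diff[OF C this paired_exchange[OF C ab x, of r]]
    have "x * r * a \<in> core N" by simp
    hence "component (x * r * a) (e + h + d) \<in> N" (is "?c \<in> N") by (simp add: core_def)
    moreover have "?c = (\<Sum>u\<in>?F. component x u * r * component a (e + d - u))"
    proof -
      have "x * r * a = (\<Sum>u\<in>?F. component x u * r * a)"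
        using sum_components_superset[of ?F x] finite_support
        by (simp add: subset_insertI flip: sum_distrib_right del: sum.insert_if sum.insert)
      moreover have "component (component x u * r * a) (e + h + d)
          = component x u * r * component a (e + d - u)" for u
        using component_mult_left[OF mult_mem[OF component_mem[of x u] homogeneous],
            where g = "e + h + d" and x = a]
        by (simp add: algebra_simps)
      ultimately show ?thesis by (simp only: component_sum)
    qed
    moreover have "\<dots> = ?y * r * b + (\<Sum>u\<in>?F - {e}. component x u * r * component a (e + d - u))"
      (is "_ = _ + ?s")
      using finite_support[of x] by (subst sum.remove[of ?F e]) (simp_all add: b)
    moreover have "?s \<in> N"
    proof (rule ideal_sum[OF N])
      (* The factors have degrees u, h and e + d - u. If the first one is not in N, then \<pi> u is at
         least \<pi> e, so the \<pi>-degree of the last one is at most \<pi> d, while its degree is not d. *)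
      fix u assume u: "u \<in> ?F - {e}"
      show "component x u * r * component a (e + d - u) \<in> N"
      proof (cases "component x u \<in> N")
        case True
        thus ?thesis using two_sided_idealD(5)[OF N] by blast
      next
        case False
        hence "\<pi> (e + d - u) \<le> \<pi> d"
          using e(2) by (simp add: additive.add[OF \<pi>] additive.diff[OF \<pi>])
        moreover have "e + d - u \<noteq> d" using u by (auto simp: algebra_simps)
        ultimately have "component a (e + d - u) \<in> N" using d by (meson not_le)
        thus ?thesis using two_sided_idealD(4)[OF N] by blast
      qed
    qed
    ultimately have "?y * r * b \<in> N"
      using ideal_diff[OF N, of ?c ?s] by simp
    thus ?case
      by (rule core_homogeneous[OF N mult_mem[OF mult_mem[OF component_mem homogeneous] bd]])
  next
    case (add r s)
    thus ?case using two_sided_idealD(2)[OF C] by (simp add: distrib_left distrib_right)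
  qed
  have yx: "?y * r * x' \<in> core N" if "paired b a x' w'" for r x' w'
    using that
  proof induction
    case zero
    show ?case using two_sided_idealD(1)[OF C] by simp
  next
    case (add x' w' p q)
    have "?y * (r * p) * b * q \<in> core N"
      using yb two_sided_idealD(5)[OF C] by blast
    from two_sided_idealD(2)[OF C add.IH this] show ?case
      by (simp add: distrib_left mult.assoc)
  qed
  have "?y * r * ?y \<in> N" for r
  proof (induction r rule: homogeneous_induct)
    case (homogeneous h r)
    have "component (?y * r * x) (e + h + e) \<in> N"
      using yx[OF x] by (simp add: core_def)
    thus ?case
      by (simp add: component_mult_left[OF mult_mem[OF component_mem homogeneous]])
  next
    case (add r s)
    thus ?case using two_sided_idealD(2)[OF N] by (simp add: distrib_left distrib_right)
  qed
  hence "?y \<in> N" by (rule semiprime)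
  thus False using e(1) by simp
qed

text \<open>
  If \<open>w\<close> to the power \<open>m + 1\<close> is 0, then \<open>z\<close> to the power \<open>k\<close> times \<open>w\<close> to the power \<open>j\<close> times
  \<open>z\<close> is in the core whenever \<open>k + j = m + 1\<close>: in the induction on \<open>k\<close> a factor \<open>w\<close> is moved to
  the front, where it can be replaced by \<open>z\<close>. The last factor \<open>z\<close> makes up for a missing identity
  element: there is something to be multiplied also when \<open>j = 0\<close>.
\<close>

lemma (in grading) paired_nilpotent:
  fixes \<pi> :: "'g \<Rightarrow> int"
  defines "N \<equiv> nil_radical"
  assumes aN: "a \<in> N"
    and ab: "\<And>r. a * r * b - b * r * a \<in> core N"
    and b: "b = component a d"
    and \<pi>: "additive \<pi>"
    and d: "\<And>g. component a g \<notin> N \<Longrightarrow> g \<noteq> d \<Longrightarrow> \<pi> d < \<pi> g"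
    and z: "paired b a z w"
  shows "nilpotent z"
proof -
  have N: "two_sided_ideal N" by (simp add: N_def nil_radical_ideal)
  note C = core_ideal[OF N]
  have semiprime: "x \<in> N" if "\<And>r. x * r * x \<in> N" for x
    using that unfolding N_def by (rule nil_radical_semiprime)
  have "w \<in> N" by (rule paired_in_ideal[OF N aN z])
  hence "nilpotent w" using nil_radical_greatest(1) by (auto simp: N_def nil_ideal_def)
  then obtain m where m: "((*) w ^^ m) w = 0" by (auto simp: nilpotent_def)
  have comm: "w * (((*) z ^^ k) y) - ((*) z ^^ k) (w * y) \<in> core N" for k y
  proof (induction k)
    case 0
    show ?case using two_sided_idealD(1)[OF C] by simp
  next
    case (Suc k)
    let ?v = "((*) z ^^ k) y"
    have "(w * z - z * w) * ?v \<in> core N"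
      using paired_commute[OF C ab z z] two_sided_idealD(5)[OF C] by blast
    moreover have "z * (w * ?v - ((*) z ^^ k) (w * y)) \<in> core N"
      using Suc two_sided_idealD(4)[OF C] by blast
    ultimately have "(w * z - z * w) * ?v + z * (w * ?v - ((*) z ^^ k) (w * y)) \<in> core N"
      by (rule two_sided_idealD(2)[OF C])
    thus ?case by (simp add: algebra_simps)
  qed
  have "((*) z ^^ k) (((*) w ^^ j) z) \<in> core N" if "k + j = Suc m" for k j
    using that
  proof (induction k arbitrary: j)
    case 0
    have "((*) w ^^ Suc m) z = 0"
      using m iterate_mult_assoc[of m w w z] by (simp add: funpow_swap1)
    thus ?case using 0 two_sided_idealD(1)[OF C] by simp
  next
    case (Suc k)
    let ?y = "((*) w ^^ j) z"
    have "((*) z ^^ k) (w * ?y) \<in> core N" using Suc.IH[of "Suc j"] Suc.prems by simp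
    from two_sided_idealD(2)[OF C comm[of k ?y] this]
    have "w * ((*) z ^^ k) ?y \<in> core N" by simp
    from paired_regular[OF N semiprime ab b \<pi> d paired_mult_right[OF z] this] show ?case by simp
  qed
  from this[of "Suc m" 0] have "((*) z ^^ Suc m) z \<in> N"
    using core_subset[OF N] by auto
  thus ?thesis unfolding N_def by (rule nilpotent_mod_nil_radical)
qed

section \<open>Homogeneity of the nil radical\<close>

text \<open>
  The set \<open>s x\<close> is the support of \<open>x\<close> modulo the core. Minimality of \<open>s a\<close> gives the exchange
  property of \<open>a\<close> and its component \<open>b\<close> of degree \<open>d\<close>, on which everything above rests: the degree
  \<open>d\<close>, shifted by the degree of \<open>r * b\<close>, drops out of the support of \<open>a * r * b - b * r * a\<close>.
\<close>

lemma (in grading) nil_radical_subset_core: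
  assumes free: "free_abelian TYPE('g)"
  shows "(nil_radical :: 'r set) \<subseteq> core nil_radical"
proof (rule ccontr)
  define N :: "'r set" where "N = nil_radical"
  have N: "two_sided_ideal N" by (simp add: N_def nil_radical_ideal)
  note C = core_ideal[OF N]
  define s where "s x = {g. component x g \<notin> N}" for x
  have fin: "finite (s x)" for x
    unfolding s_def
    by (rule finite_subset[OF _ finite_support[of x]]) (use two_sided_idealD(1)[OF N] in auto)
  assume "\<not> (nil_radical :: 'r set) \<subseteq> core nil_radical"
  then obtain x\<^sub>0 where "x\<^sub>0 \<in> N - core N" by (auto simp: N_def)
  then obtain a where a: "a \<in> N" "a \<notin> core N"
    and min: "\<And>x. x \<in> N - core N \<Longrightarrow> card (s a) \<le> card (s x)"
    using arg_min_natI[of "\<lambda>x. x \<in> N - core N" x\<^sub>0 "\<lambda>x. card (s x)"]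
      arg_min_nat_le[of "\<lambda>x. x \<in> N - core N" _ "\<lambda>x. card (s x)"] by blast
  have "s a \<noteq> {}" using a(2) by (auto simp: s_def core_def)
  then obtain \<pi> :: "'g \<Rightarrow> int" and d where \<pi>: "additive \<pi>" and d: "d \<in> s a"
    and dmin: "\<And>g. g \<in> s a \<Longrightarrow> g \<noteq> d \<Longrightarrow> \<pi> d < \<pi> g"
    using unique_minimizer[OF free fin[of a]] by blast
  let ?b = "component a d"
  have ab: "a * r * ?b - ?b * r * a \<in> core N" for r
  proof (induction r rule: homogeneous_induct)
    case (homogeneous h r)
    let ?x = "a * r * ?b - ?b * r * a"
    have comp: "component ?x g = component a (g - (h + d)) * r * ?b - ?b * r * component a (g - (h + d))" for g
      using component_mult_right[OF mult_mem[OF homogeneous component_mem[of a d]], where x = a and g = g]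
        component_mult_left[OF mult_mem[OF component_mem[of a d] homogeneous], where x = a and g = g]
      by (simp add: component_diff mult.assoc add.commute)
    have "s ?x \<subseteq> (\<lambda>g. g + (h + d)) ` (s a - {d})"
    proof
      fix g assume g: "g \<in> s ?x"
      have "g - (h + d) \<in> s a"
        using g two_sided_idealD(4,5)[OF N] by (auto simp: s_def comp intro: ideal_diff[OF N])
      moreover have "g - (h + d) \<noteq> d"
        using g two_sided_idealD(1)[OF N] by (auto simp: s_def comp)
      ultimately show "g \<in> (\<lambda>g. g + (h + d)) ` (s a - {d})"
        by (intro image_eqI[of _ _ "g - (h + d)"]) auto
    qed
    hence "card (s ?x) \<le> card (s a - {d})"
      using fin by (meson card_image_le card_mono finite_Diff finite_imageI le_trans)
    also have "\<dots> < card (s a)" using d fin by (meson card_Diff1_less)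
    finally have "card (s ?x) < card (s a)" .
    moreover have "?x \<in> N"
      using a(1) two_sided_idealD(4,5)[OF N] by (intro ideal_diff[OF N]) auto
    ultimately show ?case using min[of ?x] by force
  next
    case (add r t)
    from two_sided_idealD(2)[OF C this] show ?case by (simp add: algebra_simps)
  qed
  have "nilpotent z" if "paired ?b a z w" for z w
    using paired_nilpotent[of a ?b d \<pi> z w] a(1) ab \<pi> dmin that by (auto simp: N_def s_def)
  hence "nil_ideal {z. \<exists>w. paired ?b a z w}"
    using paired_ideal by (auto simp: nil_ideal_def)
  hence "p * ?b * q \<in> nil_radical" for p q
    using nil_radical_greatest(2) paired.add[OF paired.zero, of ?b a p q] by auto
  hence "?b \<in> N" unfolding N_def by (rule nil_radical_sandwich)
  thus False using d by (simp add: s_def)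
qed

theorem corollary0p2:
  fixes A :: "'g::ab_group_add \<Rightarrow> 'r::ring set"
  assumes "free_abelian TYPE('g)"
    and "graded_ring A"
  shows "homogeneous_ideal A (nil_radical :: 'r set)"
proof -
  interpret grading A by standard (rule assms(2))
  show ?thesis
    using homogeneous_ideal_if_core[OF nil_radical_ideal nil_radical_subset_core[OF assms(1)]] .
qed

end
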